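(* Let $n\in\mathbb R^D$, $q\in\mathbb R$, $k\ge0$, and let $\{p_1,\dots,p_{|[k]|}\}\subset\pi^+=\{x\in\mathbb R^D:n\cdot x=q\}$ be a poised set of nodes, i.e. $\det\Sigma^k_{[k]}\neq0$. Then the elementary Darboux transformed orthogonal polynomials (kernel polynomials) $TP$ and second kind functions $TC$, associated with the measure $(n\cdot x-q)\,d\mu(x)$, are given in terms of the original ones by the quasi-determinantal formulas $$(TP)_{[k]}(x)=(n\cdot x-q)^{-1}(n\cdot\Lambda)_{[k],[k+1]}\,\Theta_*\begin{pmatrix}\Sigma^k_{[k]}&P_{[k]}(x)\\ \Sigma^k_{[k+1]}&P_{[k+1]}(x)\end{pmatrix},$$ $$(TC)_{[k]}(x)=(n\cdot\Lambda)_{[k],[k+1]}\,\Theta_*\begin{pmatrix}\Sigma^k_{[k]}&C_{[k]}(x)\\ \Sigma^k_{[k+1]}&C_{[k+1]}(x)\end{pmatrix}.$$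
   Context: Let $D\ge 1$ and let $\mu$ be a Borel measure on $\Omega\subseteq\mathbb R^D$ with finite moments. For $k\in\mathbb Z_+$ let $[k]=\{\alpha\in\mathbb Z_+^D:|\alpha|=k\}$, ordered so that $\alpha>\alpha'$ iff at the first coordinate where they differ the entry of $\alpha$ is smaller. $\chi_{[k]}(x)$ is the column vector of monomials $x^\alpha$, $\alpha\in[k]$, and $\chi$ stacks $\chi_{[0]},\chi_{[1]},\dots$; $\chi^*(x)=\big(\prod_ax_a^{-1}\big)\chi(x_1^{-1},\dots,x_D^{-1})$. Semi-infinite matrices are partitioned in blocks $A_{[k],[\ell]}\in\mathbb R^{|[k]|\times|[\ell]|}$. For a measure whose moment matrix $G=\int\chi\,d\mu\,\chi^\top$ has a block Cholesky factorization $G=S^{-1}H(S^{-1})^\top$ ($S$ block lower triangular with identity diagonal blocks, $H$ block diagonal with invertible blocks), its orthogonal polynomials are $P=S\chi$ and its second kind functions are $C=H(S^{-1})^\top\chi^*$ (Laurent series), with blocks $P_{[k]}$, $C_{[k]}$. It is assumed that the moment matrices of both $d\mu(x)$ and $T\,d\mu(x):=(n\cdot x-q)d\mu(x)$ have such factorizations; $TP$, $TC$ denote the corresponding objects for $T\,d\mu$. Shift matrices: $\Lambda_a$ has as only nonzero blocks $(\Lambda_a)_{[k],[k+1]}$, with entries $\delta_{\alpha+e_a,\alpha'}$, $\alpha\in[k]$, $\alpha'\in[k+1]$; $n\cdot\Lambda=\sum_an_a\Lambda_a$. Sample matrices: $\Sigma^k_{[\ell]}=\big(P_{[\ell]}(p_1)\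 \cdots\ P_{[\ell]}(p_{|[k]|})\big)\in\mathbb R^{|[\ell]|\times|[k]|}$. Quasi-determinant: $\Theta_*\begin{pmatrix}A&B\\C&E\end{pmatrix}=E-CA^{-1}B$ (Schur complement with respect to the invertible block $A$; $E$ need not be square). *)

theory Defs
  imports
    "HOL-Analysis.Analysis"
    "HOL-Library.Groups_Big_Fun"
    "Jordan_Normal_Form.Gauss_Jordan_Elimination"
    "Jordan_Normal_Form.Determinant"
begin

no_notation Matrix.vec_index (infixl \<open>$\<close> 100)
no_notation Matrix.scalar_prod (infix \<open>\<bullet>\<close> 70)

text \<open>
  Points of \<open>R^D\<close> are elements of \<open>real ^ 'd\<close> with \<open>D = CARD('d)\<close>; the linear order on the
  index type \<open>'d\<close> says which coordinate comes first. Finite blocks are matrices with explicit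
  dimensions (\<open>Matrix.mat\<close>), since their sizes depend on the degree.
\<close>

type_synonym 'd point = "real ^ 'd"
type_synonym 'd mindex = "nat ^ 'd"
type_synonym 'd zindex = "int ^ 'd"

subsection \<open>Multi-indices\<close>

definition deg :: "'d::{finite,linorder} mindex \<Rightarrow> nat" where
  "deg \<alpha> = (\<Sum>a\<in>UNIV. \<alpha> $ a)"

definition midx :: "nat \<Rightarrow> ('d::{finite,linorder} mindex) set" where
  "midx k = {\<alpha>. deg \<alpha> = k}"

text \<open>
  \<open>mi_less \<alpha> \<beta>\<close> is \<open>\<alpha> < \<beta>\<close>: at the first coordinate where they differ, the larger
  multi-index has the smaller entry. So \<open>(k, 0, \<dots>, 0)\<close> is the first element of degree \<open>k\<close>.
\<close>

definition mi_less :: "'d::{finite,linorder} mindex \<Rightarrow> 'd mindex \<Rightarrow> bool" where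
  "mi_less \<alpha> \<beta> \<longleftrightarrow> (\<exists>a. \<beta> $ a < \<alpha> $ a \<and> (\<forall>b<a. \<alpha> $ b = \<beta> $ b))"

definition idx :: "nat \<Rightarrow> ('d::{finite,linorder} mindex) list" where
  "idx k = (THE xs. sorted_wrt mi_less xs \<and> set xs = midx k)"

lemma finite_midx: "finite (midx k :: ('d::{finite,linorder} mindex) set)"
proof -
  have "\<alpha> $ a \<le> k" if "\<alpha> \<in> midx k" for \<alpha> :: "'d mindex" and a
    using that member_le_sum[of a UNIV "\<lambda>a. \<alpha> $ a"] by (simp add: midx_def deg_def)
  then have "vec_nth ` (midx k :: ('d mindex) set) \<subseteq> (UNIV \<rightarrow>\<^sub>E {..k})"
    by auto
  then have "finite (vec_nth ` (midx k :: ('d mindex) set))"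
    by (rule finite_subset) (simp add: finite_PiE)
  then show ?thesis
    by (rule finite_imageD) (simp add: inj_on_def vec_nth_inject)
qed

lemma mi_linorder:
  "class.linorder (\<lambda>\<alpha> \<beta>. \<alpha> = \<beta> \<or> mi_less \<alpha> \<beta>) (mi_less :: 'd::{finite,linorder} mindex \<Rightarrow> _)"
proof -
  have irrefl: "\<not> mi_less \<alpha> \<alpha>" for \<alpha> :: "'d mindex"
    by (simp add: mi_less_def)
  have trans: "mi_less \<alpha> \<gamma>" if \<alpha>\<beta>: "mi_less \<alpha> \<beta>" and \<beta>\<gamma>: "mi_less \<beta> \<gamma>" for \<alpha> \<beta> \<gamma> :: "'d mindex"
  proof -
    obtain a b where a: "\<beta> $ a < \<alpha> $ a" "\<forall>c<a. \<alpha> $ c = \<beta> $ c"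
      and b: "\<gamma> $ b < \<beta> $ b" "\<forall>c<b. \<beta> $ c = \<gamma> $ c"
      using \<alpha>\<beta> \<beta>\<gamma> unfolding mi_less_def by blast
    show ?thesis
      unfolding mi_less_def
    proof (rule exI[of _ "min a b"], intro conjI allI impI)
      show "\<gamma> $ min a b < \<alpha> $ min a b"
        using a b by (cases a b rule: linorder_cases) (auto simp: min_def)
    qed (use a b in auto)
  qed
  have total: "\<alpha> = \<beta> \<or> mi_less \<alpha> \<beta> \<or> mi_less \<beta> \<alpha>" for \<alpha> \<beta> :: "'d mindex"
  proof (cases "\<alpha> = \<beta>")
    case False
    define A where "A = {a. \<alpha> $ a \<noteq> \<beta> $ a}"
    have "finite A" "A \<noteq> {}"
      using False by (auto simp: A_def Finite_Cartesian_Product.vec_eq_iff)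
    then have "Min A \<in> A" "\<And>b. b < Min A \<Longrightarrow> b \<notin> A"
      by (auto simp: leD)
    then show ?thesis
      unfolding A_def mi_less_def by (metis (mono_tags) mem_Collect_eq nat_neq_iff)
  qed simp
  show ?thesis
    by standard (use irrefl trans total in blast)+
qed

lemma idx_enumerates:
  "sorted_wrt mi_less (idx k :: ('d::{finite,linorder} mindex) list) \<and>
   set (idx k) = (midx k :: ('d mindex) set)"
proof -
  interpret mi: linorder "\<lambda>\<alpha> \<beta>. \<alpha> = \<beta> \<or> mi_less \<alpha> \<beta>" "mi_less :: 'd mindex \<Rightarrow> _"
    by (rule mi_linorder)
  have "\<exists>!xs. sorted_wrt mi_less xs \<and> set xs = (midx k :: ('d mindex) set)"
    using mi.ex1_sorted_list_for_set_if_finite[OF finite_midx] .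
  from theI'[OF this] show ?thesis
    unfolding idx_def .
qed

lemma distinct_idx: "distinct (idx k :: ('d::{finite,linorder} mindex) list)"
proof -
  interpret mi: linorder "\<lambda>\<alpha> \<beta>. \<alpha> = \<beta> \<or> mi_less \<alpha> \<beta>" "mi_less :: 'd mindex \<Rightarrow> _"
    by (rule mi_linorder)
  show ?thesis
    using idx_enumerates mi.strict_sorted_iff by blast
qed

lemma length_idx: "length (idx k :: ('d::{finite,linorder} mindex) list) = card (midx k :: ('d mindex) set)"
  using distinct_card[OF distinct_idx] idx_enumerates by metis


subsection \<open>Semi-infinite matrices and their blocks\<close>

type_synonym 'd smat = "'d mindex \<Rightarrow> 'd mindex \<Rightarrow> real"

definition block :: "'d::{finite,linorder} smat \<Rightarrow> nat \<Rightarrow> nat \<Rightarrow> real Matrix.mat" where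
  "block A k l = Matrix.mat (card (midx k :: ('d mindex) set)) (card (midx l :: ('d mindex) set))
     (\<lambda>(i, j). A (idx k ! i) (idx l ! j))"

definition col_block :: "nat \<Rightarrow> ('d::{finite,linorder} mindex \<Rightarrow> real) \<Rightarrow> real Matrix.mat" where
  "col_block k f = Matrix.mat (card (midx k :: ('d mindex) set)) 1 (\<lambda>(i, _). f (idx k ! i))"

text \<open>
  \<^const>\<open>Sum_any\<close> is the sum over the support. All supports below are finite: in each product a
  factor is block lower triangular or block diagonal on the left, or the transpose of such a
  matrix on the right, or the vector acted upon has finite support.
\<close>

definition smat_mult :: "'d::{finite,linorder} smat \<Rightarrow> 'd smat \<Rightarrow> 'd smat" where
  "smat_mult A B = (\<lambda>\<alpha> \<beta>. Sum_any (\<lambda>\<gamma>. A \<alpha> \<gamma> * B \<gamma> \<beta>))"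

definition smat_apply :: "'d::{finite,linorder} smat \<Rightarrow> ('d mindex \<Rightarrow> real) \<Rightarrow> 'd mindex \<Rightarrow> real" where
  "smat_apply A v = (\<lambda>\<alpha>. Sum_any (\<lambda>\<beta>. A \<alpha> \<beta> * v \<beta>))"

definition smat_one :: "'d::{finite,linorder} smat" where
  "smat_one = (\<lambda>\<alpha> \<beta>. if \<alpha> = \<beta> then 1 else 0)"

definition smat_transpose :: "'d::{finite,linorder} smat \<Rightarrow> 'd smat" where
  "smat_transpose A = (\<lambda>\<alpha> \<beta>. A \<beta> \<alpha>)"

definition block_lower_unitriangular :: "'d::{finite,linorder} smat \<Rightarrow> bool" where
  "block_lower_unitriangular S \<longleftrightarrow>
     (\<forall>k l. k < l \<longrightarrow> block S k l
        = 0\<^sub>m (card (midx k :: ('d mindex) set)) (card (midx l :: ('d mindex) set))) \<and>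
     (\<forall>k. block S k k = 1\<^sub>m (card (midx k :: ('d mindex) set)))"

definition block_diagonal_invertible :: "'d::{finite,linorder} smat \<Rightarrow> bool" where
  "block_diagonal_invertible H \<longleftrightarrow>
     (\<forall>k l. k \<noteq> l \<longrightarrow> block H k l
        = 0\<^sub>m (card (midx k :: ('d mindex) set)) (card (midx l :: ('d mindex) set))) \<and>
     (\<forall>k. invertible_mat (block H k k))"

text \<open>The inverse in the group of block lower unitriangular semi-infinite matrices.\<close>

definition smat_inv :: "'d::{finite,linorder} smat \<Rightarrow> 'd smat" where
  "smat_inv S = (THE R. block_lower_unitriangular R
                      \<and> smat_mult S R = smat_one \<and> smat_mult R S = smat_one)"

definition block_cholesky :: "'d::{finite,linorder} smat \<Rightarrow> 'd smat \<Rightarrow> 'd smat \<Rightarrow> bool" where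
  "block_cholesky G S H \<longleftrightarrow>
     block_lower_unitriangular S \<and> block_diagonal_invertible H \<and>
     G = smat_mult (smat_mult (smat_inv S) H) (smat_transpose (smat_inv S))"

definition shift :: "'d::{finite,linorder} \<Rightarrow> 'd smat" where
  "shift a = (\<lambda>\<alpha> \<alpha>'. if \<alpha> + axis a 1 = \<alpha>' then 1 else 0)"

definition n_shift :: "'d::{finite,linorder} point \<Rightarrow> 'd smat" where
  "n_shift n = (\<lambda>\<alpha> \<alpha>'. \<Sum>a\<in>UNIV. n $ a * shift a \<alpha> \<alpha>')"


subsection \<open>Moment matrices, orthogonal polynomials, second kind functions\<close>

definition mpow :: "'d::{finite,linorder} mindex \<Rightarrow> 'd point \<Rightarrow> real" where
  "mpow \<alpha> x = (\<Prod>a\<in>UNIV. (x $ a) ^ (\<alpha> $ a))"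

text \<open>
  The moment matrix of the possibly signed measure \<open>w d\<mu>\<close>: the original measure has \<open>w = 1\<close>, its
  elementary Darboux transform has \<open>w(x) = n \<cdot> x - q\<close>.
\<close>

definition moment_matrix ::
    "('d::{finite,linorder} point) measure \<Rightarrow> ('d point \<Rightarrow> real) \<Rightarrow> 'd smat" where
  "moment_matrix \<mu> w = (\<lambda>\<alpha> \<beta>. \<integral>x. mpow \<alpha> x * mpow \<beta> x * w x \<partial>\<mu>)"

definition ortho_poly :: "'d::{finite,linorder} smat \<Rightarrow> 'd point \<Rightarrow> 'd mindex \<Rightarrow> real" where
  "ortho_poly S x = smat_apply S (\<lambda>\<beta>. mpow \<beta> x)"

text \<open>
  A formal Laurent series in \<open>x\<close> is given by its real coefficients, and \<open>[x^\<nu>] f\<close> denotes the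
  coefficient of \<open>x^\<nu>\<close> for \<open>\<nu>\<close> of type \<open>int ^ 'd\<close>. The entry of \<open>\<chi>\<^sup>*\<close> at \<open>\<beta>\<close> is the monomial
  with exponents \<open>- 1 - \<beta>\<close>, and \<open>second_kind_coeff S H \<nu> \<alpha>\<close> is \<open>[x^\<nu>] C\<close> at \<open>\<alpha>\<close>.
\<close>

definition chi_star_coeff :: "'d::{finite,linorder} zindex \<Rightarrow> 'd mindex \<Rightarrow> real" where
  "chi_star_coeff \<nu> \<beta> = (if \<forall>a. \<nu> $ a = - 1 - int (\<beta> $ a) then 1 else 0)"

definition second_kind_coeff ::
    "'d::{finite,linorder} smat \<Rightarrow> 'd smat \<Rightarrow> 'd zindex \<Rightarrow> 'd mindex \<Rightarrow> real" where
  "second_kind_coeff S H \<nu> =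
     smat_apply (smat_mult H (smat_transpose (smat_inv S))) (chi_star_coeff \<nu>)"

definition poly_block :: "'d::{finite,linorder} smat \<Rightarrow> nat \<Rightarrow> 'd point \<Rightarrow> real Matrix.mat" where
  "poly_block S k x = col_block k (ortho_poly S x)"

definition second_kind_block_coeff ::
    "'d::{finite,linorder} smat \<Rightarrow> 'd smat \<Rightarrow> nat \<Rightarrow> 'd zindex \<Rightarrow> real Matrix.mat" where
  "second_kind_block_coeff S H k \<nu> = col_block k (second_kind_coeff S H \<nu>)"


subsection \<open>Sample matrices and quasi-determinants\<close>

text \<open>\<open>sample_matrix S p k l\<close> is \<open>\<Sigma>\<^sup>k\<^bsub>[l]\<^esub>\<close>; its nodes are \<open>p 0, \<dots>, p (|[k]| - 1)\<close>.\<close>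

definition sample_matrix ::
    "'d::{finite,linorder} smat \<Rightarrow> (nat \<Rightarrow> 'd point) \<Rightarrow> nat \<Rightarrow> nat \<Rightarrow> real Matrix.mat" where
  "sample_matrix S p k l =
     Matrix.mat (card (midx l :: ('d mindex) set)) (card (midx k :: ('d mindex) set))
       (\<lambda>(i, j). ortho_poly S (p j) (idx l ! i))"

definition poised :: "'d::{finite,linorder} smat \<Rightarrow> nat \<Rightarrow> (nat \<Rightarrow> 'd point) \<Rightarrow> bool" where
  "poised S k p \<longleftrightarrow> Determinant.det (sample_matrix S p k k) \<noteq> 0"

text \<open>
  \<^const>\<open>mat_inverse\<close> returns \<^const>\<open>None\<close> on singular matrices, so \<open>quasidet\<close> is meaningful only for
  invertible \<open>A\<close>.
\<close>

definition quasidet ::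
    "real Matrix.mat \<Rightarrow> real Matrix.mat \<Rightarrow> real Matrix.mat \<Rightarrow> real Matrix.mat \<Rightarrow> real Matrix.mat" where
  "quasidet A B C E = E - C * the (mat_inverse A) * B"

end

theory Submission
  imports Defs
begin

text \<open>
  The proof rests on the resolvent \<open>\<omega> = TS (n \<cdot> \<Lambda> - q) S\<^sup>-\<^sup>1\<close>. Since
  \<open>(n \<cdot> \<Lambda> - q) G\<close> is the moment matrix of the transformed measure, the two factorizations also give
  \<open>\<omega> H S\<^sup>-\<^sup>T = TH TS\<^sup>-\<^sup>T\<close>, so \<open>\<omega>\<close> is block upper triangular. It also vanishes above
  the first block superdiagonal, where it equals \<open>n \<cdot> \<Lambda>\<close>. From \<open>\<omega> P = (n \<cdot> x - q) TP\<close> and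
  \<open>\<omega> C = TC\<close> one obtains two-term connection formulas; evaluating the first one at the nodes, where
  \<open>n \<cdot> x - q\<close> vanishes, determines the diagonal block of \<open>\<omega>\<close>.
\<close>

subsection \<open>Products of semi-infinite matrices\<close>

text \<open>\<open>Sum_any\<close> is 0 on an infinite support, so products reassociate safely only
  while the sums involved are finite. This condition secures that for the left and middle
  factors.\<close>

definition row_finite :: "'d::{finite,linorder} smat \<Rightarrow> bool" where
  "row_finite A \<longleftrightarrow> (\<forall>\<alpha>. finite {\<beta>. A \<alpha> \<beta> \<noteq> 0})"

text \<open>Only the upper side is bounded; below the diagonal the matrix may be full. Block lower
  triangular is \<open>band 0\<close>, and the shifts, which raise the degree by one, are
  \<open>band 1\<close>.\<close>

definition band :: "nat \<Rightarrow> 'd::{finite,linorder} smat \<Rightarrow> bool" where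
  "band d A \<longleftrightarrow> (\<forall>\<alpha> \<beta>. deg \<alpha> + d < deg \<beta> \<longrightarrow> A \<alpha> \<beta> = 0)"

text \<open>Entrywise form of \<open>block_lower_unitriangular\<close>, with degree comparisons in
  place of index lists; see \<open>block_lower_unitriangular_iff\<close>.\<close>

definition unitriangular :: "'d::{finite,linorder} smat \<Rightarrow> bool" where
  "unitriangular A \<longleftrightarrow> (\<forall>\<alpha> \<beta>. deg \<alpha> \<le> deg \<beta> \<longrightarrow> A \<alpha> \<beta> = smat_one \<alpha> \<beta>)"

lemma finite_deg_le: "finite {\<alpha> :: 'd::{finite,linorder} mindex. deg \<alpha> \<le> m}"
proof -
  have "{\<alpha> :: 'd mindex. deg \<alpha> \<le> m} = (\<Union>k\<in>{..m}. midx k)"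
    by (auto simp: midx_def)
  then show ?thesis
    by (simp add: finite_midx)
qed

lemma finite_deg_less: "finite {\<alpha> :: 'd::{finite,linorder} mindex. deg \<alpha> < m}"
  by (rule finite_subset[OF _ finite_deg_le[of m]]) auto

lemma band_row_finite: "band d A \<Longrightarrow> row_finite A"
  unfolding row_finite_def band_def
  by (intro allI, rule finite_subset[OF _ finite_deg_le]) (auto simp: not_less[symmetric])

lemma unitriangular_band: "unitriangular A \<Longrightarrow> band 0 A"
  by (auto simp: unitriangular_def band_def smat_one_def)

lemma smat_mult_sum:
  assumes "finite F" and "\<And>\<gamma>. \<gamma> \<notin> F \<Longrightarrow> A \<alpha> \<gamma> * B \<gamma> \<beta> = 0"
  shows "smat_mult A B \<alpha> \<beta> = (\<Sum>\<gamma>\<in>F. A \<alpha> \<gamma> * B \<gamma> \<beta>)"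
  unfolding smat_mult_def using assms by (intro Sum_any.expand_superset) auto

text \<open>Reads a vector as a matrix with equal columns, so that facts on products carry over to
  the action on vectors.\<close>

lemma smat_apply_eq_mult: "smat_apply A v \<alpha> = smat_mult A (\<lambda>\<beta> _. v \<beta>) \<alpha> \<beta>"
  by (simp add: smat_apply_def smat_mult_def)

text \<open>A single entry involves finite sums over \<open>F\<close> and \<open>K\<close> only, and
  these can be exchanged. The condition on \<open>K\<close> concerns products of entries of
  \<open>B\<close> and \<open>C\<close>, so either a row-finite \<open>B\<close> or a column-finite
  \<open>C\<close> can supply it.\<close>

lemma smat_mult_assoc_on:
  fixes A B C :: "'d::{finite,linorder} smat"
  assumes F: "finite F" "\<And>\<gamma>. \<gamma> \<notin> F \<Longrightarrow> A \<alpha> \<gamma> = 0"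
    and K: "finite K" "\<And>\<gamma> \<delta>. \<gamma> \<in> F \<Longrightarrow> \<delta> \<notin> K \<Longrightarrow> B \<gamma> \<delta> * C \<delta> \<beta> = 0"
  shows "smat_mult (smat_mult A B) C \<alpha> \<beta> = smat_mult A (smat_mult B C) \<alpha> \<beta>"
proof -
  have AB: "smat_mult A B \<alpha> \<delta> = (\<Sum>\<gamma>\<in>F. A \<alpha> \<gamma> * B \<gamma> \<delta>)" for \<delta>
    using F by (intro smat_mult_sum) auto
  have BC: "smat_mult B C \<gamma> \<beta> = (\<Sum>\<delta>\<in>K. B \<gamma> \<delta> * C \<delta> \<beta>)" if "\<gamma> \<in> F" for \<gamma>
    using K that by (intro smat_mult_sum) auto
  have "smat_mult (smat_mult A B) C \<alpha> \<beta> = (\<Sum>\<delta>\<in>K. smat_mult A B \<alpha> \<delta> * C \<delta> \<beta>)"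
  proof (rule smat_mult_sum[OF K(1)])
    fix \<delta> assume "\<delta> \<notin> K"
    then have "(\<Sum>\<gamma>\<in>F. A \<alpha> \<gamma> * (B \<gamma> \<delta> * C \<delta> \<beta>)) = 0"
      using K(2) by (intro sum.neutral) simp
    then show "smat_mult A B \<alpha> \<delta> * C \<delta> \<beta> = 0"
      by (simp add: AB sum_distrib_right mult.assoc)
  qed
  also have "\<dots> = (\<Sum>\<delta>\<in>K. \<Sum>\<gamma>\<in>F. A \<alpha> \<gamma> * (B \<gamma> \<delta> * C \<delta> \<beta>))"
    by (simp add: AB sum_distrib_right mult.assoc)
  also have "\<dots> = (\<Sum>\<gamma>\<in>F. \<Sum>\<delta>\<in>K. A \<alpha> \<gamma> * (B \<gamma> \<delta> * C \<delta> \<beta>))"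
    by (rule sum.swap)
  also have "\<dots> = (\<Sum>\<gamma>\<in>F. A \<alpha> \<gamma> * smat_mult B C \<gamma> \<beta>)"
    by (simp add: BC sum_distrib_left)
  also have "\<dots> = smat_mult A (smat_mult B C) \<alpha> \<beta>"
    using F by (intro smat_mult_sum[symmetric]) auto
  finally show ?thesis .
qed

text \<open>Finite columns of \<open>C\<close> are what transposes of block lower triangular
  matrices and finitely supported vectors provide.\<close>

lemma smat_mult_assoc:
  fixes A B C :: "'d::{finite,linorder} smat"
  assumes "row_finite A" and "row_finite B \<or> row_finite (smat_transpose C)"
  shows "smat_mult (smat_mult A B) C = smat_mult A (smat_mult B C)"
proof (intro ext)
  fix \<alpha> \<beta> :: "'d mindex"
  let ?F = "{\<gamma>. A \<alpha> \<gamma> \<noteq> 0}"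
  have F: "finite ?F"
    using assms(1) by (simp add: row_finite_def)
  show "smat_mult (smat_mult A B) C \<alpha> \<beta> = smat_mult A (smat_mult B C) \<alpha> \<beta>"
    using assms(2)
  proof
    assume "row_finite B"
    then show ?thesis
      using F by (intro smat_mult_assoc_on[of ?F _ _ "\<Union>\<gamma>\<in>?F. {\<delta>. B \<gamma> \<delta> \<noteq> 0}"])
        (auto simp: row_finite_def)
  next
    assume "row_finite (smat_transpose C)"
    then show ?thesis
      using F by (intro smat_mult_assoc_on[of ?F _ _ "{\<delta>. C \<delta> \<beta> \<noteq> 0}"])
        (auto simp: row_finite_def smat_transpose_def)
  qed
qed

lemma smat_apply_mult:
  fixes A B :: "'d::{finite,linorder} smat"
  assumes "row_finite A" and "row_finite B \<or> finite {\<beta>. v \<beta> \<noteq> 0}"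
  shows "smat_apply (smat_mult A B) v = smat_apply A (smat_apply B v)"
proof
  fix \<alpha> :: "'d mindex"
  have "smat_apply (smat_mult A B) v \<alpha> = smat_mult (smat_mult A B) (\<lambda>\<beta> _. v \<beta>) \<alpha> \<alpha>"
    by (rule smat_apply_eq_mult)
  also have "\<dots> = smat_mult A (smat_mult B (\<lambda>\<beta> _. v \<beta>)) \<alpha> \<alpha>"
    using assms by (subst smat_mult_assoc) (auto simp: row_finite_def smat_transpose_def)
  also have "\<dots> = smat_apply A (smat_apply B v) \<alpha>"
    by (simp add: smat_apply_def smat_mult_def)
  finally show "smat_apply (smat_mult A B) v \<alpha> = smat_apply A (smat_apply B v) \<alpha>" .
qed

lemma smat_mult_one_left [simp]: "smat_mult smat_one (A :: 'd::{finite,linorder} smat) = A"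
proof (intro ext)
  fix \<alpha> \<beta> :: "'d mindex"
  show "smat_mult smat_one A \<alpha> \<beta> = A \<alpha> \<beta>"
    by (subst smat_mult_sum[of "{\<alpha>}"]) (auto simp: smat_one_def)
qed

lemma smat_mult_one_right [simp]: "smat_mult (A :: 'd::{finite,linorder} smat) smat_one = A"
proof (intro ext)
  fix \<alpha> \<beta> :: "'d mindex"
  show "smat_mult A smat_one \<alpha> \<beta> = A \<alpha> \<beta>"
    by (subst smat_mult_sum[of "{\<beta>}"]) (auto simp: smat_one_def)
qed

lemma smat_apply_one [simp]: "smat_apply smat_one (v :: 'd::{finite,linorder} mindex \<Rightarrow> real) = v"
proof
  fix \<alpha> :: "'d mindex"
  show "smat_apply smat_one v \<alpha> = v \<alpha>"
    by (simp add: smat_apply_eq_mult[where \<beta> = \<alpha>])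
qed

lemma smat_transpose_mult:
  "smat_transpose (smat_mult A B) = smat_mult (smat_transpose B) (smat_transpose A)"
  by (simp add: smat_transpose_def smat_mult_def mult.commute)

lemma smat_transpose_one [simp]: "smat_transpose smat_one = smat_one"
  by (auto simp: smat_transpose_def smat_one_def fun_eq_iff)

lemma smat_transpose_transpose [simp]: "smat_transpose (smat_transpose A) = A"
  by (simp add: smat_transpose_def)

lemma smat_mult_band:
  fixes A B :: "'d::{finite,linorder} smat"
  assumes A: "band d A" and B: "band e B"
  shows "band (d + e) (smat_mult A B)"
  unfolding band_def
proof (intro allI impI)
  fix \<alpha> \<beta> :: "'d mindex" assume less: "deg \<alpha> + (d + e) < deg \<beta>"
  have "A \<alpha> \<gamma> * B \<gamma> \<beta> = 0" for \<gamma>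
  proof (cases "deg \<alpha> + d < deg \<gamma>")
    case False
    then have "deg \<gamma> + e < deg \<beta>"
      using less by linarith
    then show ?thesis
      using B by (simp add: band_def)
  qed (use A in \<open>simp add: band_def\<close>)
  then show "smat_mult A B \<alpha> \<beta> = 0"
    by (subst smat_mult_sum[of "{}"]) (simp_all del: mult_eq_0_iff)
qed

text \<open>On the outermost superdiagonal only \<gamma> = \<alpha> contributes: \<open>A\<close>
  kills every other \<gamma> of at least the degree of \<alpha>, and from a lower degree
  \<open>B\<close> would have to jump by more than \<open>e\<close>.\<close>

lemma unitriangular_mult_top:
  fixes A B :: "'d::{finite,linorder} smat"
  assumes A: "unitriangular A" and B: "band e B" and deg: "deg \<beta> = deg \<alpha> + e"
  shows "smat_mult A B \<alpha> \<beta> = B \<alpha> \<beta>"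
proof -
  have "A \<alpha> \<gamma> * B \<gamma> \<beta> = 0" if "\<gamma> \<noteq> \<alpha>" for \<gamma>
  proof (cases "deg \<alpha> \<le> deg \<gamma>")
    case True
    then show ?thesis
      using A that by (simp add: unitriangular_def smat_one_def)
  next
    case False
    then show ?thesis
      using B deg by (simp add: band_def)
  qed
  then have "smat_mult A B \<alpha> \<beta> = (\<Sum>\<gamma>\<in>{\<alpha>}. A \<alpha> \<gamma> * B \<gamma> \<beta>)"
    by (intro smat_mult_sum) auto
  then show ?thesis
    using A by (simp add: unitriangular_def smat_one_def)
qed

lemma mult_unitriangular_top:
  fixes A B :: "'d::{finite,linorder} smat"
  assumes A: "band e A" and B: "unitriangular B" and deg: "deg \<beta> = deg \<alpha> + e"
  shows "smat_mult A B \<alpha> \<beta> = A \<alpha> \<beta>"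
proof -
  have "A \<alpha> \<gamma> * B \<gamma> \<beta> = 0" if "\<gamma> \<noteq> \<beta>" for \<gamma>
  proof (cases "deg \<gamma> \<le> deg \<beta>")
    case True
    then show ?thesis
      using B that by (simp add: unitriangular_def smat_one_def)
  next
    case False
    then show ?thesis
      using A deg by (simp add: band_def)
  qed
  then have "smat_mult A B \<alpha> \<beta> = (\<Sum>\<gamma>\<in>{\<beta>}. A \<alpha> \<gamma> * B \<gamma> \<beta>)"
    by (intro smat_mult_sum) auto
  then show ?thesis
    using B by (simp add: unitriangular_def smat_one_def)
qed


subsection \<open>Inverses of block lower unitriangular matrices\<close>

text \<open>Solves S R = 1 for R row by row in order of degree. The diagonal blocks of S are meant
  to be identities, so nothing has to be divided out.\<close>

function forward_subst :: "'d::{finite,linorder} smat \<Rightarrow> 'd smat" where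
  "forward_subst S \<alpha> \<beta> =
     smat_one \<alpha> \<beta> - (\<Sum>\<gamma> | deg \<gamma> < deg \<alpha>. S \<alpha> \<gamma> * forward_subst S \<gamma> \<beta>)"
  by pat_completeness auto
termination
  by (relation "Wellfounded.measure (\<lambda>(S, \<alpha>, \<beta>). deg \<alpha>)") auto

declare forward_subst.simps [simp del]

text \<open>If deg \<alpha> \<le> deg \<beta>, every \<gamma> in the recursive sum has lower degree
  than \<beta>; by induction its entry is an off-diagonal entry of the identity, hence 0.\<close>

lemma unitriangular_forward_subst: "unitriangular (forward_subst (S :: 'd::{finite,linorder} smat))"
proof -
  have "deg \<alpha> \<le> deg \<beta> \<Longrightarrow> forward_subst S \<alpha> \<beta> = smat_one \<alpha> \<beta>" for \<alpha> \<beta> :: "'d mindex"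
  proof (induction "deg \<alpha>" arbitrary: \<alpha> rule: less_induct)
    case less
    have "(\<Sum>\<gamma> | deg \<gamma> < deg \<alpha>. S \<alpha> \<gamma> * forward_subst S \<gamma> \<beta>) = 0"
    proof (rule sum.neutral, rule ballI)
      fix \<gamma> :: "'d mindex" assume "\<gamma> \<in> {\<gamma>. deg \<gamma> < deg \<alpha>}"
      then have "forward_subst S \<gamma> \<beta> = smat_one \<gamma> \<beta>" "\<gamma> \<noteq> \<beta>"
        using less by auto
      then show "S \<alpha> \<gamma> * forward_subst S \<gamma> \<beta> = 0"
        by (simp add: smat_one_def)
    qed
    then show ?case
      by (simp add: forward_subst.simps[of S \<alpha>])
  qed
  then show ?thesis
    by (simp add: unitriangular_def)
qed

lemma mult_forward_subst:
  fixes S :: "'d::{finite,linorder} smat"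
  assumes "unitriangular S"
  shows "smat_mult S (forward_subst S) = smat_one"
proof (intro ext)
  fix \<alpha> \<beta> :: "'d mindex"
  let ?F = "{\<gamma>. deg \<gamma> < deg \<alpha>}"
  have "smat_mult S (forward_subst S) \<alpha> \<beta> = (\<Sum>\<gamma>\<in>insert \<alpha> ?F. S \<alpha> \<gamma> * forward_subst S \<gamma> \<beta>)"
    using assms
    by (intro smat_mult_sum) (auto simp: finite_deg_less unitriangular_def smat_one_def not_less)
  also have "\<dots> = forward_subst S \<alpha> \<beta> + (\<Sum>\<gamma>\<in>?F. S \<alpha> \<gamma> * forward_subst S \<gamma> \<beta>)"
    using assms by (simp add: finite_deg_less unitriangular_def smat_one_def)
  also have "\<dots> = smat_one \<alpha> \<beta>"
    by (simp add: forward_subst.simps[of S \<alpha>])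
  finally show "smat_mult S (forward_subst S) \<alpha> \<beta> = smat_one \<alpha> \<beta>" .
qed

section \<open>Translation between blocks and entries\<close>

lemma idx_nth_mem:
  "i < card (midx k :: ('d::{finite,linorder} mindex) set) \<Longrightarrow> (idx k ! i :: 'd mindex) \<in> midx k"
  using idx_enumerates[where 'd = 'd] length_idx[where 'd = 'd] nth_mem by metis

lemma idx_surj:
  assumes "\<alpha> \<in> (midx k :: ('d::{finite,linorder} mindex) set)"
  obtains i where "i < card (midx k :: ('d mindex) set)" "idx k ! i = \<alpha>"
  using assms idx_enumerates[of k, where 'd = 'd] length_idx[of k, where 'd = 'd]
  by (metis in_set_conv_nth)

lemma sum_midx:
  "(\<Sum>\<gamma>\<in>(midx k :: ('d::{finite,linorder} mindex) set). f \<gamma>) =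
   (\<Sum>i = 0..<card (midx k :: ('d mindex) set). f (idx k ! i))"
proof -
  have "bij_betw ((!) (idx k :: 'd mindex list)) {0..<card (midx k :: ('d mindex) set)} (midx k)"
    by (rule bij_betw_nth[OF distinct_idx])
      (simp_all add: length_idx idx_enumerates atLeast0LessThan)
  from sum.reindex_bij_betw[OF this, of f] show ?thesis
    by simp
qed

lemma block_eq_iff:
  fixes A B :: "'d::{finite,linorder} smat"
  shows "block A k l = block B k l \<longleftrightarrow> (\<forall>\<alpha>\<in>midx k. \<forall>\<beta>\<in>midx l. A \<alpha> \<beta> = B \<alpha> \<beta>)" (is "?L \<longleftrightarrow> ?R")
proof
  assume L: ?L
  show ?R
  proof (intro ballI)
    fix \<alpha> \<beta> :: "'d mindex" assume "\<alpha> \<in> midx k" "\<beta> \<in> midx l"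
    then obtain i j where "i < card (midx k :: ('d mindex) set)" "idx k ! i = \<alpha>"
      "j < card (midx l :: ('d mindex) set)" "idx l ! j = \<beta>"
      by (metis idx_surj)
    then show "A \<alpha> \<beta> = B \<alpha> \<beta>"
      using arg_cong[OF L, of "\<lambda>M. M $$ (i, j)"] by (simp add: block_def)
  qed
next
  assume ?R
  then show ?L
    by (intro eq_matI) (auto simp: block_def idx_nth_mem)
qed

text \<open>Writing zero and identity blocks as blocks of semi-infinite matrices makes
  \<open>block_eq_iff\<close> applicable to them.\<close>

lemma block_zero:
  "block ((\<lambda>_ _. 0) :: 'd smat) k l =
     0\<^sub>m (card (midx k :: ('d::{finite,linorder} mindex) set)) (card (midx l :: ('d mindex) set))"
  by (intro eq_matI) (auto simp: block_def)

lemma block_one: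
  "block (smat_one :: 'd smat) k k = 1\<^sub>m (card (midx k :: ('d::{finite,linorder} mindex) set))"
  by (intro eq_matI)
    (auto simp: block_def smat_one_def nth_eq_iff_index_eq[OF distinct_idx] length_idx)

lemma block_lower_unitriangular_iff:
  fixes S :: "'d::{finite,linorder} smat"
  shows "block_lower_unitriangular S \<longleftrightarrow> unitriangular S"
proof -
  have "block_lower_unitriangular S \<longleftrightarrow>
    (\<forall>\<alpha> \<beta>. deg \<alpha> < deg \<beta> \<longrightarrow> S \<alpha> \<beta> = 0) \<and>
    (\<forall>\<alpha> \<beta>. deg \<alpha> = deg \<beta> \<longrightarrow> S \<alpha> \<beta> = smat_one \<alpha> \<beta>)"
    unfolding block_lower_unitriangular_def block_zero[symmetric] block_one[symmetric] block_eq_iff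
    by (auto simp: midx_def)
  also have "\<dots> \<longleftrightarrow> unitriangular S"
    unfolding unitriangular_def smat_one_def
    by (metis le_less nat_neq_iff order_less_imp_le)
  finally show ?thesis .
qed

text \<open>\<open>smat_inv\<close> is a definite description, so existence and uniqueness of a
  two-sided inverse must be shown; forward substitution supplies it.\<close>

lemma smat_inv:
  fixes S :: "'d::{finite,linorder} smat"
  assumes S: "unitriangular S"
  shows "unitriangular (smat_inv S)" "smat_mult S (smat_inv S) = smat_one"
    "smat_mult (smat_inv S) S = smat_one"
proof -
  let ?R = "forward_subst S"
  let ?Q = "forward_subst ?R"
  note tri = S unitriangular_forward_subst[of S] unitriangular_forward_subst[of ?R]
  note fin = tri[THEN unitriangular_band, THEN band_row_finite]
  have SR: "smat_mult S ?R = smat_one" and RQ: "smat_mult ?R ?Q = smat_one"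
    using tri by (auto intro: mult_forward_subst)
  \<comment> \<open>The right inverse of \<open>?R\<close> is \<open>S\<close> itself, which makes
    \<open>?R\<close> a left inverse too.\<close>
  have "?Q = smat_mult (smat_mult S ?R) ?Q"
    by (simp add: SR)
  also have "\<dots> = S"
    using fin by (simp add: smat_mult_assoc RQ)
  finally have RS: "smat_mult ?R S = smat_one"
    using RQ by simp
  have "smat_inv S = ?R"
    unfolding smat_inv_def block_lower_unitriangular_iff
  proof (rule the_equality)
    fix R assume R: "unitriangular R \<and> smat_mult S R = smat_one \<and> smat_mult R S = smat_one"
    then have "R = smat_mult (smat_mult ?R S) R"
      by (simp add: RS)
    also have "\<dots> = ?R"
      using fin R by (simp add: smat_mult_assoc)
    finally show "R = ?R" .
  qed (use tri SR RS in auto)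
  then show "unitriangular (smat_inv S)" "smat_mult S (smat_inv S) = smat_one"
    "smat_mult (smat_inv S) S = smat_one"
    using tri SR RS by auto
qed


subsection \<open>Block decomposition of products\<close>

lemma block_dim [simp]:
  "block (A :: 'd::{finite,linorder} smat) k l \<in> carrier_mat (card (midx k :: ('d mindex) set))
     (card (midx l :: ('d mindex) set))"
  by (simp add: block_def)

lemma col_block_dim [simp]:
  "col_block k (f :: 'd::{finite,linorder} mindex \<Rightarrow> real) \<in> carrier_mat (card (midx k :: ('d mindex) set)) 1"
  by (simp add: col_block_def)

text \<open>The free column index of \<open>F\<close> lets one computation serve both for a block of
  a matrix and for a column vector.\<close>

lemma block_mult_index:
  fixes A :: "'d::{finite,linorder} smat"
  assumes "i < card (midx k :: ('d mindex) set)"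
    and "j < m"
  shows "(block A k l * Matrix.mat (card (midx l :: ('d mindex) set)) m
            (\<lambda>(i, j). F (idx l ! i) j)) $$ (i, j) =
         (\<Sum>\<gamma>\<in>midx l. A (idx k ! i) \<gamma> * F \<gamma> j)"
  using assms by (simp add: block_def scalar_prod_def sum_midx)

lemma block_smat_mult:
  fixes A B :: "'d::{finite,linorder} smat"
  assumes "\<And>\<gamma> \<beta>. deg \<beta> = l \<Longrightarrow> deg \<gamma> \<noteq> l \<Longrightarrow> B \<gamma> \<beta> = 0"
  shows "block (smat_mult A B) k l = block A k l * block B l l"
proof (rule eq_matI)
  fix i j assume "i < dim_row (block A k l * block B l l)" "j < dim_col (block A k l * block B l l)"
  then have i: "i < card (midx k :: ('d mindex) set)" and j: "j < card (midx l :: ('d mindex) set)"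
    by (auto simp: block_def)
  have "B \<gamma> (idx l ! j) = 0" if "\<gamma> \<notin> midx l" for \<gamma>
    using assms[of "idx l ! j" \<gamma>] idx_nth_mem[OF j] that by (auto simp: midx_def)
  then have "smat_mult A B (idx k ! i) (idx l ! j) =
      (\<Sum>\<gamma>\<in>midx l. A (idx k ! i) \<gamma> * B \<gamma> (idx l ! j))"
    by (intro smat_mult_sum) (auto simp: finite_midx)
  also have "\<dots> = (block A k l * block B l l) $$ (i, j)"
    using block_mult_index[OF i j, of A l "\<lambda>\<gamma> j. B \<gamma> (idx l ! j)"]
    by (simp add: block_def[of B])
  finally show "block (smat_mult A B) k l $$ (i, j) = (block A k l * block B l l) $$ (i, j)"
    using i j by (simp add: block_def)
qed (auto simp: block_def)

text \<open>Source of the two-term connection formulas, with \<open>l = k + 1\<close> and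
  \<open>A\<close> the resolvent.\<close>

lemma col_block_smat_apply:
  fixes A :: "'d::{finite,linorder} smat"
  assumes "\<And>\<alpha> \<beta>. deg \<alpha> = k \<Longrightarrow> deg \<beta> \<noteq> k \<Longrightarrow> deg \<beta> \<noteq> l \<Longrightarrow> A \<alpha> \<beta> = 0" and "k \<noteq> l"
  shows "col_block k (smat_apply A v) = block A k k * col_block k v + block A k l * col_block l v"
    (is "_ = ?R")
proof (rule eq_matI)
  fix i j assume "i < dim_row ?R" "j < dim_col ?R"
  then have i: "i < card (midx k :: ('d mindex) set)" and j: "j = 0"
    by (auto simp: block_def col_block_def)
  let ?\<alpha> = "idx k ! i"
  have "A ?\<alpha> \<gamma> = 0" if "\<gamma> \<notin> midx k \<union> midx l" for \<gamma>
    using assms(1)[of ?\<alpha> \<gamma>] idx_nth_mem[OF i] that by (auto simp: midx_def)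
  then have "smat_apply A v ?\<alpha> = (\<Sum>\<gamma>\<in>midx k \<union> midx l. A ?\<alpha> \<gamma> * v \<gamma>)"
    unfolding smat_apply_eq_mult[where \<beta> = ?\<alpha>]
    by (intro smat_mult_sum) (auto simp: finite_midx)
  also have "\<dots> = (\<Sum>\<gamma>\<in>midx k. A ?\<alpha> \<gamma> * v \<gamma>) + (\<Sum>\<gamma>\<in>midx l. A ?\<alpha> \<gamma> * v \<gamma>)"
    using \<open>k \<noteq> l\<close> by (intro sum.union_disjoint finite_midx) (auto simp: midx_def)
  also have "\<dots> = ?R $$ (i, j)"
    using i j block_mult_index[OF i, of 0 1 A _ "\<lambda>\<gamma> _. v \<gamma>"]
    by (simp add: col_block_def block_def[of A, THEN arg_cong[of _ _ dim_row]])
  finally show "col_block k (smat_apply A v) $$ (i, j) = ?R $$ (i, j)"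
    using i j by (simp add: col_block_def)
qed (auto simp: block_def col_block_def)


subsection \<open>The resolvent\<close>

text \<open>The matrix of multiplication by n.x - q: applied to the vector of monomials it
  multiplies each of them by n.x - q.\<close>

definition darboux_factor :: "'d::{finite,linorder} point \<Rightarrow> real \<Rightarrow> 'd smat" where
  "darboux_factor n q = (\<lambda>\<alpha> \<beta>. n_shift n \<alpha> \<beta> - q * smat_one \<alpha> \<beta>)"

definition resolvent ::
    "'d::{finite,linorder} point \<Rightarrow> real \<Rightarrow> 'd smat \<Rightarrow> 'd smat \<Rightarrow> 'd smat" where
  "resolvent n q S TS = smat_mult (smat_mult TS (darboux_factor n q)) (smat_inv S)"

lemma deg_shift: "deg (\<alpha> + axis a 1) = Suc (deg \<alpha>)"
  by (simp add: deg_def sum.distrib axis_def)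

lemma band_darboux_factor: "band 1 (darboux_factor n q)"
  by (auto simp: band_def darboux_factor_def n_shift_def shift_def smat_one_def deg_shift
      simp del: One_nat_def intro!: sum.neutral)

lemma smat_mult_darboux_factor:
  fixes n :: "'d::{finite,linorder} point"
  shows "smat_mult (darboux_factor n q) B \<alpha> \<beta> =
     (\<Sum>a\<in>UNIV. n $ a * B (\<alpha> + axis a 1) \<beta>) - q * B \<alpha> \<beta>"
proof -
  let ?F = "insert \<alpha> (range (\<lambda>a. \<alpha> + axis a 1))"
  have "darboux_factor n q \<alpha> \<gamma> = 0" if "\<gamma> \<notin> ?F" for \<gamma>
    using that by (auto simp: darboux_factor_def n_shift_def shift_def smat_one_def intro!: sum.neutral)
  then have "smat_mult (darboux_factor n q) B \<alpha> \<beta> =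
      (\<Sum>\<gamma>\<in>?F. darboux_factor n q \<alpha> \<gamma> * B \<gamma> \<beta>)"
    by (intro smat_mult_sum) auto
  also have "\<dots> = (\<Sum>\<gamma>\<in>?F. n_shift n \<alpha> \<gamma> * B \<gamma> \<beta>) - (\<Sum>\<gamma>\<in>?F. q * (smat_one \<alpha> \<gamma> * B \<gamma> \<beta>))"
    by (simp only: darboux_factor_def left_diff_distrib sum_subtractf mult.assoc)
  also have "(\<Sum>\<gamma>\<in>?F. q * (smat_one \<alpha> \<gamma> * B \<gamma> \<beta>)) = (\<Sum>\<gamma>\<in>?F. if \<gamma> = \<alpha> then q * B \<alpha> \<beta> else 0)"
    by (intro sum.cong) (auto simp: smat_one_def)
  also have "\<dots> = q * B \<alpha> \<beta>"
    by (subst sum.delta) auto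
  \<comment> \<open>Exchanging the sums leaves, for each \<open>a\<close>, an inner sum with the
    single term \<gamma> = \<alpha> + e_a, so the range need not be reindexed by
    \<open>a\<close>.\<close>
  also have "(\<Sum>\<gamma>\<in>?F. n_shift n \<alpha> \<gamma> * B \<gamma> \<beta>) =
      (\<Sum>a\<in>UNIV. \<Sum>\<gamma>\<in>?F. if \<gamma> = \<alpha> + axis a 1 then n $ a * B \<gamma> \<beta> else 0)"
    unfolding n_shift_def sum_distrib_right
    by (subst sum.swap) (auto simp: shift_def intro!: sum.cong)
  also have "\<dots> = (\<Sum>a\<in>UNIV. n $ a * B (\<alpha> + axis a 1) \<beta>)"
    by (intro sum.cong refl, subst sum.delta) auto
  finally show ?thesis .
qed

section \<open>Monomials and moments under the shifts\<close>

lemma mpow_shift: "mpow (\<alpha> + axis a 1) x = x $ a * mpow \<alpha> x"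
proof -
  have "mpow (\<alpha> + axis a 1) x = (\<Prod>b\<in>UNIV. (x $ b) ^ (\<alpha> $ b) * (if b = a then x $ a else 1))"
    unfolding mpow_def by (intro prod.cong) (auto simp: axis_def power_add)
  then show ?thesis
    by (simp add: prod.distrib mpow_def mult.commute)
qed

lemma mpow_add: "mpow (\<alpha> + \<beta>) x = mpow \<alpha> x * mpow \<beta> x"
  by (simp add: mpow_def power_add prod.distrib)

lemma moment_matrix_darboux:
  fixes \<mu> :: "('d::{finite,linorder} point) measure"
  assumes moments: "\<And>\<alpha>. integrable \<mu> (mpow \<alpha>)"
  shows "moment_matrix \<mu> (\<lambda>x. inner n x - q) =
    smat_mult (darboux_factor n q) (moment_matrix \<mu> (\<lambda>_. 1))"
proof (intro ext)
  fix \<alpha> \<beta> :: "'d mindex"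
  \<comment> \<open>A product of monomials is a monomial, so finite moments make every term
    integrable and the integral can be split.\<close>
  have int: "integrable \<mu> (\<lambda>x. mpow \<alpha> x * mpow \<beta> x)" for \<alpha> \<beta> :: "'d mindex"
    using moments[of "\<alpha> + \<beta>"] by (simp add: mpow_add[abs_def])
  have "moment_matrix \<mu> (\<lambda>x. inner n x - q) \<alpha> \<beta> =
    (\<integral>x. (\<Sum>a\<in>UNIV. n $ a * (mpow (\<alpha> + axis a 1) x * mpow \<beta> x)) - q * (mpow \<alpha> x * mpow \<beta> x) \<partial>\<mu>)"
    unfolding moment_matrix_def
    by (intro Bochner_Integration.integral_cong)
      (simp_all add: mpow_shift inner_vec_def algebra_simps sum_distrib_left del: One_nat_def)
  also have "\<dots> = (\<Sum>a\<in>UNIV. n $ a * (\<integral>x. mpow (\<alpha> + axis a 1) x * mpow \<beta> x \<partial>\<mu>))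
      - q * (\<integral>x. mpow \<alpha> x * mpow \<beta> x \<partial>\<mu>)"
    using int by (subst Bochner_Integration.integral_diff) simp_all
  also have "\<dots> = smat_mult (darboux_factor n q) (moment_matrix \<mu> (\<lambda>_. 1)) \<alpha> \<beta>"
    by (simp add: smat_mult_darboux_factor moment_matrix_def)
  finally show "moment_matrix \<mu> (\<lambda>x. inner n x - q) \<alpha> \<beta> =
    smat_mult (darboux_factor n q) (moment_matrix \<mu> (\<lambda>_. 1)) \<alpha> \<beta>" .
qed

section \<open>Block structure of the resolvent and its action\<close>

lemma block_diagonal_entry:
  fixes H :: "'d::{finite,linorder} smat"
  assumes "block_diagonal_invertible H" and "deg \<alpha> \<noteq> deg \<beta>"
  shows "H \<alpha> \<beta> = 0"
proof -
  have "block H (deg \<alpha>) (deg \<beta>) = block ((\<lambda>_ _. 0) :: 'd smat) (deg \<alpha>) (deg \<beta>)"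
    using assms by (simp add: block_diagonal_invertible_def block_zero)
  then show ?thesis
    by (auto simp: block_eq_iff midx_def)
qed

lemma resolvent_band:
  assumes "unitriangular S" and "unitriangular TS"
  shows "band 1 (resolvent n q S TS)"
  using smat_mult_band[OF smat_mult_band[OF unitriangular_band[OF assms(2)] band_darboux_factor]
      unitriangular_band[OF smat_inv(1)[OF assms(1)]]]
  by (simp add: resolvent_def)

text \<open>On the first superdiagonal the unitriangular outer factors act as the identity, and the
  term with \<open>q\<close> sits on the diagonal.\<close>

lemma block_resolvent_superdiagonal:
  fixes S TS :: "'d::{finite,linorder} smat"
  assumes S: "unitriangular S" and TS: "unitriangular TS"
  shows "block (resolvent n q S TS) k (k + 1) = block (n_shift n) k (k + 1)"
  unfolding block_eq_iff
proof (intro ballI)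
  fix \<alpha> \<beta> :: "'d mindex" assume "\<alpha> \<in> midx k" "\<beta> \<in> midx (k + 1)"
  then have deg: "deg \<beta> = deg \<alpha> + 1"
    by (simp add: midx_def)
  have band: "band 1 (smat_mult TS (darboux_factor n q))"
    using smat_mult_band[OF unitriangular_band[OF TS] band_darboux_factor] by simp
  have "resolvent n q S TS \<alpha> \<beta> = darboux_factor n q \<alpha> \<beta>"
    unfolding resolvent_def
    using mult_unitriangular_top[OF band smat_inv(1)[OF S] deg]
      unitriangular_mult_top[OF TS band_darboux_factor deg] by simp
  then show "resolvent n q S TS \<alpha> \<beta> = n_shift n \<alpha> \<beta>"
    using deg by (auto simp: darboux_factor_def smat_one_def)
qed

lemma resolvent_ortho_poly:
  fixes S TS :: "'d::{finite,linorder} smat"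
  assumes S: "unitriangular S" and TS: "unitriangular TS"
  shows "smat_apply (resolvent n q S TS) (ortho_poly S x) = (\<lambda>\<alpha>. (inner n x - q) * ortho_poly TS x \<alpha>)"
proof -
  let ?L = "darboux_factor n q" and ?\<chi> = "\<lambda>\<beta>. mpow \<beta> x"
  have bands: "band 0 S" "band 0 TS" "band 0 (smat_inv S)" "band 1 ?L"
    using S TS band_darboux_factor by (simp_all add: unitriangular_band smat_inv)
  note fin = bands[THEN band_row_finite]
  have TL: "row_finite (smat_mult TS ?L)"
    using smat_mult_band[OF bands(2,4)] by (rule band_row_finite)
  \<comment> \<open>The monomial vector is an eigenvector of the Darboux factor; the rest is
    cancellation of S^-1 S.\<close>
  have \<chi>: "smat_apply ?L ?\<chi> = (\<lambda>\<alpha>. (inner n x - q) * mpow \<alpha> x)"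
  proof
    fix \<alpha> :: "'d mindex"
    show "smat_apply ?L ?\<chi> \<alpha> = (inner n x - q) * mpow \<alpha> x"
      unfolding smat_apply_eq_mult[where \<beta> = \<alpha>] smat_mult_darboux_factor
      by (simp add: mpow_shift inner_vec_def algebra_simps sum_distrib_left del: One_nat_def)
  qed
  have "smat_apply (resolvent n q S TS) (ortho_poly S x) =
      smat_apply (smat_mult TS ?L) (smat_apply (smat_mult (smat_inv S) S) ?\<chi>)"
    using fin TL by (simp add: resolvent_def ortho_poly_def smat_apply_mult)
  also have "\<dots> = smat_apply TS (\<lambda>\<alpha>. (inner n x - q) * mpow \<alpha> x)"
    using fin S by (simp add: smat_inv smat_apply_mult \<chi>)
  also have "\<dots> = (\<lambda>\<alpha>. (inner n x - q) * ortho_poly TS x \<alpha>)"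
  proof
    fix \<alpha> :: "'d mindex"
    have F: "finite {\<beta>. TS \<alpha> \<beta> \<noteq> 0}"
      using fin by (simp add: row_finite_def)
    show "smat_apply TS (\<lambda>\<alpha>. (inner n x - q) * mpow \<alpha> x) \<alpha> = (inner n x - q) * ortho_poly TS x \<alpha>"
      unfolding ortho_poly_def smat_apply_eq_mult[where \<beta> = \<alpha>]
      by (subst (1 2) smat_mult_sum[OF F]) (auto simp: sum_distrib_left mult_ac)
  qed
  finally show ?thesis .
qed

text \<open>S^-1 H S^-T reassembles to G, leaving TS times the transformed moment matrix, whose own
  factorization then cancels TS. A transposed inverse may have infinite rows, but it only ever
  stands last in a product.\<close>

lemma resolvent_cholesky:
  assumes G: "block_cholesky G S H" and TG: "block_cholesky (smat_mult (darboux_factor n q) G) TS TH"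
  shows "smat_mult (resolvent n q S TS) (smat_mult H (smat_transpose (smat_inv S))) =
    smat_mult TH (smat_transpose (smat_inv TS))"
proof -
  let ?L = "darboux_factor n q" and ?U = "smat_inv S" and ?V = "smat_inv TS"
  have S: "unitriangular S" and TS: "unitriangular TS"
    and H: "block_diagonal_invertible H" and TH: "block_diagonal_invertible TH"
    and Geq: "G = smat_mult (smat_mult ?U H) (smat_transpose ?U)"
    and TGeq: "smat_mult ?L G = smat_mult (smat_mult ?V TH) (smat_transpose ?V)"
    using G TG by (auto simp: block_cholesky_def block_lower_unitriangular_iff)
  have "band 0 H" "band 0 TH"
    using block_diagonal_entry[OF H] block_diagonal_entry[OF TH] by (auto simp: band_def)
  then have bands: "band 0 S" "band 0 TS" "band 0 ?U" "band 0 ?V" "band 1 ?L" "band 0 H" "band 0 TH"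
    using S TS band_darboux_factor by (simp_all add: unitriangular_band smat_inv)
  note fin = bands[THEN band_row_finite]
  have TL: "row_finite (smat_mult TS ?L)"
    using smat_mult_band[OF bands(2,5)] by (rule band_row_finite)
  have LU: "row_finite (smat_mult ?L ?U)"
    using smat_mult_band[OF bands(5,3)] by (rule band_row_finite)
  have "smat_mult (resolvent n q S TS) (smat_mult H (smat_transpose ?U)) =
      smat_mult TS (smat_mult ?L G)"
    using fin TL LU by (simp add: resolvent_def Geq smat_mult_assoc)
  also have "\<dots> = smat_mult (smat_mult TS ?V) (smat_mult TH (smat_transpose ?V))"
    using fin by (simp add: TGeq smat_mult_assoc)
  finally show ?thesis
    by (simp add: smat_inv TS)
qed

text \<open>Multiplying \<open>resolvent_cholesky\<close> on the right by S^T gives \<omega> H = TH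
  W with W = TS^-T S^T block upper triangular. So \<omega> H vanishes below the diagonal blocks, and
  the invertible diagonal blocks of H can be cancelled.\<close>

lemma resolvent_upper:
  fixes G :: "'d::{finite,linorder} smat"
  assumes G: "block_cholesky G S H" and TG: "block_cholesky (smat_mult (darboux_factor n q) G) TS TH"
    and deg: "deg \<beta> < deg \<alpha>"
  shows "resolvent n q S TS \<alpha> \<beta> = 0"
proof -
  let ?\<omega> = "resolvent n q S TS" and ?U = "smat_inv S" and ?V = "smat_inv TS"
  have S: "unitriangular S" and TS: "unitriangular TS"
    and H: "block_diagonal_invertible H" and TH: "block_diagonal_invertible TH"
    using G TG by (auto simp: block_cholesky_def block_lower_unitriangular_iff)
  have \<omega>: "row_finite ?\<omega>"
    using resolvent_band[OF S TS] by (rule band_row_finite)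
  have fin: "row_finite H" "row_finite TH" "row_finite S"
    using block_diagonal_entry[OF H] block_diagonal_entry[OF TH] unitriangular_band[OF S]
    by (auto intro!: band_row_finite[of 0] simp: band_def)
  define W where "W = smat_transpose (smat_mult S ?V)"
  have W: "W \<gamma> \<delta> = 0" if "deg \<delta> < deg \<gamma>" for \<gamma> \<delta>
    using smat_mult_band[OF unitriangular_band[OF S] unitriangular_band[OF smat_inv(1)[OF TS]]] that
    by (simp add: W_def band_def smat_transpose_def)
  have "smat_mult ?\<omega> H =
      smat_mult ?\<omega> (smat_mult H (smat_mult (smat_transpose ?U) (smat_transpose S)))"
    by (simp add: smat_transpose_mult[symmetric] smat_inv S)
  also have "\<dots> = smat_mult (smat_mult ?\<omega> (smat_mult H (smat_transpose ?U))) (smat_transpose S)"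
    using fin \<omega> by (simp add: smat_mult_assoc)
  also have "\<dots> = smat_mult TH W"
    unfolding resolvent_cholesky[OF G TG] using fin
    by (simp add: smat_mult_assoc W_def smat_transpose_mult)
  finally have eq: "smat_mult ?\<omega> H = smat_mult TH W" .
  let ?k = "deg \<alpha>" and ?l = "deg \<beta>"
  let ?nk = "card (midx (deg \<alpha>) :: ('d mindex) set)" and ?nl = "card (midx (deg \<beta>) :: ('d mindex) set)"
  \<comment> \<open>\<open>TH\<close> forces \<gamma> to have the degree of \<alpha>', which exceeds
    that of \<beta>', where \<open>W\<close> is 0.\<close>
  have "TH \<alpha>' \<gamma> * W \<gamma> \<beta>' = 0" if "deg \<alpha>' = ?k" "deg \<beta>' = ?l" for \<alpha>' \<beta>' \<gamma> :: "'d mindex"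
    using that deg block_diagonal_entry[OF TH, of \<alpha>' \<gamma>] W[of \<beta>' \<gamma>] by (cases "deg \<gamma> = ?k") auto
  then have "block (smat_mult ?\<omega> H) ?k ?l = block ((\<lambda>_ _. 0) :: 'd smat) ?k ?l"
    unfolding eq block_eq_iff
    by (intro ballI, subst smat_mult_sum[of "{}"]) (simp_all add: midx_def del: mult_eq_0_iff)
  moreover have "block (smat_mult ?\<omega> H) ?k ?l = block ?\<omega> ?k ?l * block H ?l ?l"
    using block_diagonal_entry[OF H] by (intro block_smat_mult) auto
  ultimately have zero: "block ?\<omega> ?k ?l * block H ?l ?l = 0\<^sub>m ?nk ?nl"
    by (simp add: block_zero)
  obtain B where HB: "block H ?l ?l * B = 1\<^sub>m ?nl" and B: "B \<in> carrier_mat ?nl ?nl"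
  proof -
    have "invertible_mat (block H ?l ?l)"
      using H by (simp add: block_diagonal_invertible_def)
    then obtain B where "inverts_mat (block H ?l ?l) B" "inverts_mat B (block H ?l ?l)"
      by (auto simp: invertible_mat_def)
    then have "block H ?l ?l * B = 1\<^sub>m ?nl" "B * block H ?l ?l = 1\<^sub>m (dim_row B)"
      by (auto simp: inverts_mat_def block_def)
    \<comment> \<open>\<open>inverts_mat\<close> does not fix the shape of \<open>B\<close>; it is
      read off from the two products.\<close>
    moreover from this have "dim_col B = ?nl" "dim_row B = ?nl"
      by (metis index_mult_mat(3) index_one_mat(3),
          metis block_dim carrier_matD(2) index_mult_mat(3) index_one_mat(3))
    ultimately show ?thesis
      using that by blast
  qed
  have "block ?\<omega> ?k ?l = block ?\<omega> ?k ?l * (block H ?l ?l * B)"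
    by (simp add: HB right_mult_one_mat[OF block_dim])
  also have "\<dots> = (block ?\<omega> ?k ?l * block H ?l ?l) * B"
    by (rule assoc_mult_mat[OF block_dim block_dim B, symmetric])
  also have "\<dots> = block ((\<lambda>_ _. 0) :: 'd smat) ?k ?l"
    using B by (simp add: zero block_zero)
  finally show ?thesis
    by (auto simp: block_eq_iff midx_def)
qed

text \<open>For a fixed exponent \<nu> at most one entry of \<chi>* contributes, the one with
  \<beta> = - 1 - \<nu>. This finite support permits reassociation although H S^-T may have infinite
  rows.\<close>

lemma second_kind_resolvent:
  fixes G :: "'d::{finite,linorder} smat"
  assumes G: "block_cholesky G S H" and TG: "block_cholesky (smat_mult (darboux_factor n q) G) TS TH"
  shows "smat_apply (resolvent n q S TS) (second_kind_coeff S H \<nu>) = second_kind_coeff TS TH \<nu>"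
proof -
  have S: "unitriangular S" and TS: "unitriangular TS"
    using G TG by (auto simp: block_cholesky_def block_lower_unitriangular_iff)
  have \<omega>: "row_finite (resolvent n q S TS)"
    using resolvent_band[OF S TS] by (rule band_row_finite)
  have "\<beta> = \<gamma>" if "chi_star_coeff \<nu> \<beta> \<noteq> 0" "chi_star_coeff \<nu> \<gamma> \<noteq> 0" for \<beta> \<gamma>
  proof -
    have "int (\<beta> $ a) = int (\<gamma> $ a)" for a
      using that by (auto simp: chi_star_coeff_def split: if_splits)
    then show ?thesis
      by (simp add: Finite_Cartesian_Product.vec_eq_iff)
  qed
  \<comment> \<open>With empty support the chosen element is arbitrary and the inclusion still
    holds.\<close>
  then have "{\<beta>. chi_star_coeff \<nu> \<beta> \<noteq> 0} \<subseteq> {SOME \<beta>. chi_star_coeff \<nu> \<beta> \<noteq> 0}"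
    by (metis (mono_tags, lifting) mem_Collect_eq singletonI someI subsetI)
  then have "finite {\<beta>. chi_star_coeff \<nu> \<beta> \<noteq> 0}"
    by (rule finite_subset) simp
  then show ?thesis
    unfolding second_kind_coeff_def resolvent_cholesky[OF G TG, symmetric]
    using \<omega> by (simp add: smat_apply_mult)
qed


subsection \<open>The quasi-determinantal formulas\<close>

lemma sample_matrix_dim [simp]:
  "sample_matrix (S :: 'd::{finite,linorder} smat) p k l \<in> carrier_mat (card (midx l :: ('d mindex) set))
     (card (midx k :: ('d mindex) set))"
  by (simp add: sample_matrix_def)

text \<open>Column \<open>j\<close> of a sample matrix is the polynomial block at the node
  \<open>p j\<close>; that block has a single column, hence the index 0.\<close>

lemma block_mult_sample_matrix_index:
  fixes A S :: "'d::{finite,linorder} smat"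
  assumes "i < card (midx m :: ('d mindex) set)" and "j < card (midx k :: ('d mindex) set)"
  shows "(block A m l * sample_matrix S p k l) $$ (i, j) = (block A m l * poly_block S l (p j)) $$ (i, 0)"
  using assms by (simp add: block_def sample_matrix_def poly_block_def col_block_def scalar_prod_def)

text \<open>The relation \<open>zero\<close> says W = - M C A^-1, so the Schur complement E - C A^-1
  B multiplied by M equals M E + W B. This eliminates the unknown W.\<close>

lemma mult_quasidet:
  assumes A: "A \<in> carrier_mat r r" and det: "Determinant.det A \<noteq> 0"
    and B: "B \<in> carrier_mat r c" and C: "C \<in> carrier_mat s r" and E: "E \<in> carrier_mat s c"
    and M: "M \<in> carrier_mat r s" and W: "W \<in> carrier_mat r r"
    and zero: "W * A + M * C = 0\<^sub>m r r"
  shows "M * quasidet A B C E = W * B + M * E"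
proof -
  \<comment> \<open>Invertibility guarantees that \<open>mat_inverse\<close> returns
    \<open>Some\<close>, so \<open>the\<close> yields the true inverse.\<close>
  have "A \<in> Units (ring_mat TYPE(real) r ())"
    using det_non_zero_imp_unit[OF A det] .
  then obtain I where I: "mat_inverse A = Some I"
    using mat_inverse(1)[OF A, of "()"] by (cases "mat_inverse A") auto
  have AI: "A * I = 1\<^sub>m r" and Ic: "I \<in> carrier_mat r r"
    using mat_inverse(2)[OF A I] by auto
  have MC: "M * C \<in> carrier_mat r r" and WA: "W * A \<in> carrier_mat r r"
    using M C W A by auto
  have MCW: "M * C = - (W * A)"
  proof (rule eq_matI)
    fix i j assume "i < dim_row (- (W * A))" "j < dim_col (- (W * A))"
    then show "(M * C) $$ (i, j) = (- (W * A)) $$ (i, j)"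
      using arg_cong[OF zero, of "\<lambda>N. N $$ (i, j)"] MC WA A W M C by auto
  qed (use A W M C in auto)
  have "M * (C * I * B) = (M * C) * I * B"
    using M C Ic B by (simp add: assoc_mult_mat[of _ r s _ r _ c] assoc_mult_mat[of _ s r _ r _ c]
        assoc_mult_mat[of _ r r _ r _ c] assoc_mult_mat[of _ r s _ r _ r])
  also have "\<dots> = - (W * (A * I) * B)"
    using W A Ic B WA unfolding MCW by (simp add: assoc_mult_mat[of _ r r _ r _ r])
  also have "\<dots> = - (W * B)"
    using W by (simp add: AI)
  finally have CIB: "M * (C * I * B) = - (W * B)" .
  have "M * quasidet A B C E = M * E - M * (C * I * B)"
    unfolding quasidet_def I option.sel using M C Ic B E by (intro mult_minus_distrib_mat) auto
  also have "\<dots> = W * B + M * E"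
    unfolding CIB using M W B E by (intro eq_matI) auto
  finally show ?thesis .
qed

theorem theorem3p4p1:
  fixes n :: "'d::{finite,linorder} point" and q :: real
    and \<Omega> :: "('d point) set" and \<mu> :: "('d point) measure"
    and S H TS TH :: "'d smat"
    and k :: nat and p :: "nat \<Rightarrow> 'd point"
  assumes borel: "sets \<mu> = sets (restrict_space borel \<Omega>)"
    and moments: "\<And>\<alpha>. integrable \<mu> (mpow \<alpha>)"
    and factorization: "block_cholesky (moment_matrix \<mu> (\<lambda>_. 1)) S H"
    and T_factorization: "block_cholesky (moment_matrix \<mu> (\<lambda>x. inner n x - q)) TS TH"
    and nodes: "\<And>i. i < card (midx k :: ('d mindex) set) \<Longrightarrow> inner n (p i) = q"
    and poised: "poised S k p"
  shows "(\<forall>x. inner n x \<noteq> q \<longrightarrow>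
            poly_block TS k x =
              inverse (inner n x - q) \<cdot>\<^sub>m
                (block (n_shift n) k (k + 1) *
                 quasidet (sample_matrix S p k k) (poly_block S k x)
                          (sample_matrix S p k (k + 1)) (poly_block S (k + 1) x))) \<and>
         (\<forall>\<nu>. second_kind_block_coeff TS TH k \<nu> =
                block (n_shift n) k (k + 1) *
                quasidet (sample_matrix S p k k) (second_kind_block_coeff S H k \<nu>)
                         (sample_matrix S p k (k + 1)) (second_kind_block_coeff S H (k + 1) \<nu>))"
proof -
  let ?\<omega> = "resolvent n q S TS" and ?M = "block (n_shift n) k (k + 1)"
  let ?W = "block (resolvent n q S TS) k k"
  have TG: "block_cholesky (smat_mult (darboux_factor n q) (moment_matrix \<mu> (\<lambda>_. 1))) TS TH"
    using T_factorization by (simp add: moment_matrix_darboux[OF moments])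
  have S: "unitriangular S" and TS: "unitriangular TS"
    using factorization TG by (auto simp: block_cholesky_def block_lower_unitriangular_iff)
  \<comment> \<open>In block row \<open>k\<close> only two blocks survive:
    \<open>resolvent_upper\<close> removes degrees below \<open>k\<close>,
    \<open>resolvent_band\<close> those above \<open>k + 1\<close>.\<close>
  have connect: "col_block k (smat_apply ?\<omega> v) = ?W * col_block k v + ?M * col_block (k + 1) v" for v
    unfolding block_resolvent_superdiagonal[OF S TS, of n q, symmetric]
  proof (rule col_block_smat_apply)
    fix \<alpha> \<beta> :: "'d mindex" assume "deg \<alpha> = k" "deg \<beta> \<noteq> k" "deg \<beta> \<noteq> k + 1"
    then show "?\<omega> \<alpha> \<beta> = 0"
      using resolvent_upper[OF factorization TG, of \<beta> \<alpha>] resolvent_band[OF S TS]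
      by (cases "deg \<beta> < k") (auto simp: band_def)
  qed simp
  have poly: "(inner n x - q) \<cdot>\<^sub>m poly_block TS k x = ?W * poly_block S k x + ?M * poly_block S (k + 1) x"
    for x
  proof -
    have "(inner n x - q) \<cdot>\<^sub>m poly_block TS k x = col_block k (smat_apply ?\<omega> (ortho_poly S x))"
      unfolding resolvent_ortho_poly[OF S TS] poly_block_def
      by (intro eq_matI) (auto simp: col_block_def)
    then show ?thesis
      by (simp add: connect poly_block_def)
  qed
  \<comment> \<open>Column \<open>j\<close> is the connection formula at the node
    \<open>p j\<close>, where the factor n.x - q vanishes. This is the linear system for the
    diagonal block \<open>?W\<close>.\<close>
  have zero: "?W * sample_matrix S p k k + ?M * sample_matrix S p k (k + 1) =
    0\<^sub>m (card (midx k :: ('d mindex) set)) (card (midx k :: ('d mindex) set))" (is "?Z = 0\<^sub>m ?N ?N")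
  proof (rule eq_matI)
    fix i j assume "i < dim_row (0\<^sub>m ?N ?N)" "j < dim_col (0\<^sub>m ?N ?N)"
    then have ij: "i < ?N" "j < ?N"
      by auto
    have "?Z $$ (i, j) = (?W * poly_block S k (p j) + ?M * poly_block S (k + 1) (p j)) $$ (i, 0)"
      using ij block_mult_sample_matrix_index[OF ij, of _ _ S p]
      by (simp add: block_def[THEN arg_cong[of _ _ dim_row]] poly_block_def
          col_block_def[THEN arg_cong[of _ _ dim_col]] sample_matrix_def[THEN arg_cong[of _ _ dim_col]])
    also have "\<dots> = 0"
      unfolding poly[symmetric] using ij by (simp add: nodes poly_block_def col_block_def)
    finally show "?Z $$ (i, j) = 0\<^sub>m ?N ?N $$ (i, j)"
      using ij by simp
  qed (auto simp: block_def sample_matrix_def)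
  \<comment> \<open>Keeping \<open>v\<close> free serves both formulas: \<open>v\<close> becomes
    P(x) or one coefficient vector of the Laurent series C.\<close>
  have quasidet: "?M * quasidet (sample_matrix S p k k) (col_block k v)
      (sample_matrix S p k (k + 1)) (col_block (k + 1) v) = col_block k (smat_apply ?\<omega> v)" for v
    unfolding connect using poised unfolding poised_def
    by (rule mult_quasidet[OF sample_matrix_dim _ col_block_dim sample_matrix_dim col_block_dim
          block_dim block_dim zero])
  show ?thesis
  proof (intro conjI allI impI)
    \<comment> \<open>Off the hyperplane the factor n.x - q cancels against its inverse; on it
      \<open>inverse\<close> would take the default value 0.\<close>
    fix x assume "inner n x \<noteq> q"
    then show "poly_block TS k x = inverse (inner n x - q) \<cdot>\<^sub>m
        (?M * quasidet (sample_matrix S p k k) (poly_block S k x)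
          (sample_matrix S p k (k + 1)) (poly_block S (k + 1) x))"
      unfolding poly_block_def quasidet resolvent_ortho_poly[OF S TS]
      by (intro eq_matI) (auto simp: col_block_def)
  next
    fix \<nu>
    show "second_kind_block_coeff TS TH k \<nu> =
        ?M * quasidet (sample_matrix S p k k) (second_kind_block_coeff S H k \<nu>)
          (sample_matrix S p k (k + 1)) (second_kind_block_coeff S H (k + 1) \<nu>)"
      by (simp add: second_kind_block_coeff_def quasidet
          second_kind_resolvent[OF factorization TG] del: add_Suc_right One_nat_def)
  qed
qed

end
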